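(* Let $A$ be a Gorenstein algebra of finite vector space dimension greater than $1$ over a field $\mathbb{F}$ of characteristic zero, with maximal ideal $\mathfrak{m}$, and let $\pi$ be an admissible projection on $\mathfrak{m}$. Then the group $\mathrm{Aff}(S_{\pi})$ acts transitively on $S_{\pi}$ if and only if the algebra $A$ has Property (P).
   Context: Let $\mathbb{F}$ be a field of characteristic zero. A Gorenstein algebra of finite vector space dimension greater than $1$ over $\mathbb{F}$ is a local commutative associative unital $\mathbb{F}$-algebra $A$ with $1<\dim_{\mathbb{F}}A<\infty$ whose maximal ideal $\mathfrak{m}$ has 1-dimensional annihilator $\mathrm{Ann}(\mathfrak{m}):=\{u\in\mathfrak{m}: u\cdot\mathfrak{m}=0\}$ (dimension over $\mathbb{F}$). Let $\mathbf{1}$ be the unit of $A$. The ideal $\mathfrak{m}$ is nilpotent. An admissible projection on $\mathfrak{m}$ is an $\mathbb{F}$-linear projection $\pi:\mathfrak{m}\to\mathfrak{m}$ ($\pi^2=\pi$) with range $\mathrm{Ann}(\mathfrak{m})$. Define the affine quadric $Q'_{\pi}:=\{u\in\mathfrak{m}:\pi(2u+u^2)=0\}$ and the map $\log(\mathbf{1}+u):=\sum_{m=1}^{\infty}\frac{(-1)^{m+1}}{m}u^m\in\mathfrak{m}$ for $u\in\mathfrak{m}$ (a finite sum). The hypersurface associated to $\pi$ is $$S_{\pi}:=\{\log(\mathbf{1}+u): u\in Q'_{\pi}\}\subset\mathfrak{m}.$$ $\mathrm{Aff}(\mathfrak{m})$ is the group of all bijective affine transformations of the $\mathbb{F}$-vector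 space $\mathfrak{m}$, and for $\mathcal{S}\subset\mathfrak{m}$, $\mathrm{Aff}(\mathcal{S}):=\{f\in\mathrm{Aff}(\mathfrak{m}):f(\mathcal{S})=\mathcal{S}\}$. $\mathbb{T}$ denotes the set of all hyperplanes (linear subspaces of codimension 1) in $\mathfrak{m}$ complementary to $\mathrm{Ann}(\mathfrak{m})$. The group $\mathrm{Aut}(\mathfrak{m})$ of $\mathbb{F}$-algebra automorphisms of the (non-unital) algebra $\mathfrak{m}$ acts on $\mathbb{T}$ by $\Pi\mapsto\varphi(\Pi)$. The algebra $A$ has Property (P) if this action of $\mathrm{Aut}(\mathfrak{m})$ on $\mathbb{T}$ is transitive. *)

theory Defs
  imports Complex_Main "HOL-Library.FuncSet"
begin

text \<open>
  The algebra is a whole type \<open>'a :: comm_ring_1\<close>, made into a vector space over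
  \<open>'f :: field_char_0\<close> by an explicit scalar multiplication \<open>scale\<close>. Maps from the maximal
  ideal \<open>M\<close> to itself are functions on \<open>'a\<close> of which only the values on \<open>M\<close> matter; where such maps
  are collected into a set they are required to be \<^const>\<open>extensional\<close>, so that the elements of
  the set are exactly the maps \<open>M \<rightarrow> M\<close> in question.
\<close>

text \<open>Ideals are the submodules of the regular module.\<close>

definition maximal_ideal :: "'a::comm_ring_1 set \<Rightarrow> bool" where
  "maximal_ideal N \<longleftrightarrow>
     module.subspace (*) N \<and> N \<noteq> UNIV \<and>
     (\<forall>J. module.subspace (*) J \<and> N \<subseteq> J \<longrightarrow> J = N \<or> J = UNIV)"

definition Ann :: "'a::comm_ring_1 set \<Rightarrow> 'a set" where
  "Ann M = {u \<in> M. \<forall>v\<in>M. u * v = 0}"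

text \<open>
  Finite-dimensionality is stated separately because \<^const>\<open>vector_space.dim\<close> has
  the value \<open>0\<close> on infinite-dimensional spaces.
\<close>

locale gorenstein_algebra = vector_space scale
  for scale :: "'f::field_char_0 \<Rightarrow> 'a::comm_ring_1 \<Rightarrow> 'a" +
  fixes M :: "'a set"
  assumes scale_mult_left: "scale c (x * y) = scale c x * y"
    and finite_dimensional: "\<exists>B. finite B \<and> span B = UNIV"
    and dim_gt_1: "1 < dim UNIV"
    and maximal_ideal_M: "maximal_ideal M"
    and maximal_ideal_unique: "maximal_ideal N \<Longrightarrow> N = M"
    and dim_Ann: "dim (Ann M) = 1"

definition linear_endo ::
  "('f::field_char_0 \<Rightarrow> 'a::comm_ring_1 \<Rightarrow> 'a) \<Rightarrow> 'a set \<Rightarrow> ('a \<Rightarrow> 'a) \<Rightarrow> bool" where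
  "linear_endo scale M f \<longleftrightarrow>
     f \<in> M \<rightarrow> M \<and>
     (\<forall>x\<in>M. \<forall>y\<in>M. f (x + y) = f x + f y) \<and>
     (\<forall>c. \<forall>x\<in>M. f (scale c x) = scale c (f x))"

definition admissible_projection ::
  "('f::field_char_0 \<Rightarrow> 'a::comm_ring_1 \<Rightarrow> 'a) \<Rightarrow> 'a set \<Rightarrow> ('a \<Rightarrow> 'a) \<Rightarrow> bool" where
  "admissible_projection scale M \<pi> \<longleftrightarrow>
     linear_endo scale M \<pi> \<and> (\<forall>u\<in>M. \<pi> (\<pi> u) = \<pi> u) \<and> \<pi> ` M = Ann M"

definition affine_quadric :: "'a::comm_ring_1 set \<Rightarrow> ('a \<Rightarrow> 'a) \<Rightarrow> 'a set" where
  "affine_quadric M \<pi> = {u \<in> M. \<pi> (2 * u + u\<^sup>2) = 0}"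

text \<open>
  The argument \<open>u\<close> stands for the point \<open>1 + u\<close>. The series is written as the sum of its nonzero
  terms, of which there are finitely many because \<open>u\<close> is nilpotent.
\<close>

definition log_one_plus ::
  "('f::field_char_0 \<Rightarrow> 'a::comm_ring_1 \<Rightarrow> 'a) \<Rightarrow> 'a \<Rightarrow> 'a" where
  "log_one_plus scale u =
     (\<Sum>m | 1 \<le> m \<and> u ^ m \<noteq> 0. scale ((-1) ^ (m + 1) / of_nat m) (u ^ m))"

definition hypersurface ::
  "('f::field_char_0 \<Rightarrow> 'a::comm_ring_1 \<Rightarrow> 'a) \<Rightarrow> 'a set \<Rightarrow> ('a \<Rightarrow> 'a) \<Rightarrow> 'a set" where
  "hypersurface scale M \<pi> = log_one_plus scale ` affine_quadric M \<pi>"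

definition Aff ::
  "('f::field_char_0 \<Rightarrow> 'a::comm_ring_1 \<Rightarrow> 'a) \<Rightarrow> 'a set \<Rightarrow> ('a \<Rightarrow> 'a) set" where
  "Aff scale M =
     {f \<in> extensional M. bij_betw f M M \<and>
        (\<exists>L. linear_endo scale M L \<and> (\<exists>b\<in>M. \<forall>x\<in>M. f x = L x + b))}"

definition Aff_of ::
  "('f::field_char_0 \<Rightarrow> 'a::comm_ring_1 \<Rightarrow> 'a) \<Rightarrow> 'a set \<Rightarrow> 'a set \<Rightarrow> ('a \<Rightarrow> 'a) set" where
  "Aff_of scale M S = {f \<in> Aff scale M. f ` S = S}"

definition Aut ::
  "('f::field_char_0 \<Rightarrow> 'a::comm_ring_1 \<Rightarrow> 'a) \<Rightarrow> 'a set \<Rightarrow> ('a \<Rightarrow> 'a) set" where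
  "Aut scale M =
     {\<phi> \<in> extensional M. bij_betw \<phi> M M \<and> linear_endo scale M \<phi> \<and>
        (\<forall>x\<in>M. \<forall>y\<in>M. \<phi> (x * y) = \<phi> x * \<phi> y)}"

definition complementary_hyperplanes ::
  "('f::field_char_0 \<Rightarrow> 'a::comm_ring_1 \<Rightarrow> 'a) \<Rightarrow> 'a set \<Rightarrow> 'a set set" where
  "complementary_hyperplanes scale M =
     {H. module.subspace scale H \<and> H \<subseteq> M \<and>
         vector_space.dim scale M = vector_space.dim scale H + 1 \<and>
         H \<inter> Ann M = {0} \<and> {h + a | h a. h \<in> H \<and> a \<in> Ann M} = M}"

definition acts_transitively :: "'g set \<Rightarrow> ('g \<Rightarrow> 'x \<Rightarrow> 'x) \<Rightarrow> 'x set \<Rightarrow> bool" where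
  "acts_transitively G act X \<longleftrightarrow> (\<forall>x\<in>X. \<forall>y\<in>X. \<exists>g\<in>G. act g x = y)"

definition property_P ::
  "('f::field_char_0 \<Rightarrow> 'a::comm_ring_1 \<Rightarrow> 'a) \<Rightarrow> 'a set \<Rightarrow> bool" where
  "property_P scale M \<longleftrightarrow>
     acts_transitively (Aut scale M) (\<lambda>\<phi> H. \<phi> ` H) (complementary_hyperplanes scale M)"

end

theory Submission
  imports Defs "HOL-Computational_Algebra.Formal_Power_Series"
begin

section \<open>Ideals as submodules, and truncated products of sums\<close>

lemma module_mult: "module ((*) :: 'a::comm_ring_1 \<Rightarrow> 'a \<Rightarrow> 'a)"
  by unfold_locales (simp_all add: algebra_simps)

lemma subspace_mult_iff:
  "module.subspace (*) (N :: 'a::comm_ring_1 set) \<longleftrightarrow>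
     0 \<in> N \<and> (\<forall>x\<in>N. \<forall>y\<in>N. x + y \<in> N) \<and> (\<forall>c. \<forall>x\<in>N. c * x \<in> N)"
  by (rule module.subspace_def[OF module_mult])

text \<open>
  Let \<open>y\<close> be a point of the hypersurface \<open>S\<close> of \<open>\<pi>\<close>. Since
  \<open>exp (2 * (x + y)) = exp (2 * y) * exp (2 * x)\<close>, the translate \<open>S - y\<close> is the hypersurface of
  the admissible projection \<open>v \<mapsto> \<pi> (exp (2 * y) * v)\<close>, and by nondegeneracy of
  \<open>(u, v) \<mapsto> \<pi> (u * v)\<close> modulo the annihilator every hyperplane complementary to the annihilator
  is the kernel of such a projection. So points of \<open>S\<close> correspond to hyperplanes. An automorphism
  matching two kernels matches the two translates of \<open>S\<close>. Conversely, the linear part of an affine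
  symmetry carries one translate onto another, and a linear bijection between hypersurfaces of
  admissible projections is automatically multiplicative.
\<close>

unbundle fps_syntax

text \<open>Pairs with \<open>N \<le> i + j\<close> contribute nothing, so the square of indices
  shrinks to a triangle. This Cauchy product serves power series in one nilpotent element as well as
  the addition law of the exponential.\<close>

lemma sum_mult_sum_eq_triangle:
  fixes X Y :: "nat \<Rightarrow> 'a::comm_ring_1"
  assumes "\<And>i j. N \<le> i + j \<Longrightarrow> X i * Y j = 0"
  shows "(\<Sum>i<N. X i) * (\<Sum>j<N. Y j) = (\<Sum>k<N. \<Sum>i\<le>k. X i * Y (k - i))"
proof -
  have "(\<Sum>i<N. X i) * (\<Sum>j<N. Y j) = (\<Sum>(i, j)\<in>{..<N} \<times> {..<N}. X i * Y j)"
    by (simp add: sum_product sum.cartesian_product)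
  also have "\<dots> = (\<Sum>(i, j)\<in>{(i, j). i + j < N}. X i * Y j)"
    using assms by (intro sum.mono_neutral_right) (auto simp flip: not_le)
  also have "\<dots> = (\<Sum>k<N. \<Sum>i\<le>k. X i * Y (k - i))"
    by (rule sum.triangle_reindex)
  finally show ?thesis .
qed

section \<open>Units, nilpotency and the annihilator in a local algebra\<close>

context gorenstein_algebra
begin

text \<open>Dimension counting takes place relative to a fixed basis as locale parameter, so one is
  chosen by extracting it from the finite spanning set.\<close>

sublocale finite_dimensional_vector_space scale
  "SOME B. finite B \<and> independent B \<and> span B = UNIV"
proof -
  from finite_dimensional obtain B where B: "finite B" "span B = UNIV" by blast
  from maximal_independent_subset[of B] obtain C
    where C: "C \<subseteq> B" "independent C" "B \<subseteq> span C" by blast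
  have "span C = UNIV"
    using C B by (metis span_mono span_span top.extremum_uniqueI)
  moreover have "finite C"
    using C(1) B(1) by (rule finite_subset)
  ultimately have "\<exists>B. finite B \<and> independent B \<and> span B = UNIV"
    using C(2) by (intro exI conjI)
  from someI_ex[OF this] show
    "finite_dimensional_vector_space scale (SOME B. finite B \<and> independent B \<and> span B = UNIV)"
    by (intro finite_dimensional_vector_space.intro vector_space_axioms
          finite_dimensional_vector_space_axioms.intro) (elim conjE; assumption)+
qed

lemma scale_mult_right: "scale c (x * y) = x * scale c y"
  by (metis mult.commute scale_mult_left)

lemma ideal_M: "module.subspace (*) M"
  using maximal_ideal_M unfolding maximal_ideal_def by blast

lemma zero_in_M [simp]: "0 \<in> M"
  and add_in_M [intro]: "x \<in> M \<Longrightarrow> y \<in> M \<Longrightarrow> x + y \<in> M"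
  and mult_in_M [intro]: "x \<in> M \<Longrightarrow> c * x \<in> M"
  using ideal_M unfolding subspace_mult_iff by auto

lemma mult_in_M' [intro]: "x \<in> M \<Longrightarrow> x * c \<in> M"
  by (metis mult.commute mult_in_M)

lemma one_notin_M: "1 \<notin> M"
proof
  assume "1 \<in> M"
  then have "M = UNIV" using mult_in_M[of 1] by auto
  then show False using maximal_ideal_M unfolding maximal_ideal_def by blast
qed

lemma subspace_of_ideal:
  assumes "module.subspace (*) N" shows "subspace N"
proof -
  have "scale c x \<in> N" if "x \<in> N" for c x
  proof -
    have "scale c 1 * x \<in> N" using assms that unfolding subspace_mult_iff by blast
    then show ?thesis by (simp flip: scale_mult_left)
  qed
  with assms show ?thesis unfolding subspace_def subspace_mult_iff by blast
qed

lemma subspace_M: "subspace M"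
  using ideal_M subspace_of_ideal by blast

lemma scale_in_M [intro]: "x \<in> M \<Longrightarrow> scale c x \<in> M"
  using subspace_M subspace_scale by blast

lemma diff_in_M [intro]: "x \<in> M \<Longrightarrow> y \<in> M \<Longrightarrow> x - y \<in> M"
  using subspace_M subspace_diff by blast

lemma ideal_principal: "module.subspace (*) (range ((*) x))"
  unfolding subspace_mult_iff
proof (intro conjI ballI allI)
  show "0 \<in> range ((*) x)" by (metis mult_zero_right rangeI)
  show "y + z \<in> range ((*) x)" if "y \<in> range ((*) x)" "z \<in> range ((*) x)" for y z
    using that by (auto simp flip: distrib_left)
  show "c * y \<in> range ((*) x)" if "y \<in> range ((*) x)" for c y
    using that by (auto simp: mult.left_commute[of c x])
qed

text \<open>A non-unit generates a proper ideal. Among the proper ideals above it, one of greatest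
  dimension is maximal, hence equal to \<open>M\<close>; finite dimension takes the place of Zorn's
  lemma.\<close>

lemma unit_if_notin_M:
  assumes "x \<notin> M" obtains y where "x * y = 1"
proof (rule ccontr)
  assume neg: "\<not> thesis"
  let ?P = "\<lambda>J. module.subspace (*) J \<and> J \<noteq> UNIV \<and> range ((*) x) \<subseteq> J"
  have "range ((*) x) \<noteq> UNIV"
    using neg that by (metis UNIV_I imageE)
  then have "?P (range ((*) x))" using ideal_principal by blast
  moreover have "\<forall>J. ?P J \<longrightarrow> dim J < Suc dimension"
    using dim_subset_UNIV by (simp add: le_imp_less_Suc)
  ultimately have "\<exists>N. ?P N \<and> (\<forall>J. ?P J \<longrightarrow> dim J \<le> dim N)"
    by (rule ex_has_greatest_nat)
  then obtain N where N: "?P N" and max: "\<And>J. ?P J \<Longrightarrow> dim J \<le> dim N"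
    by blast
  have "maximal_ideal N"
    unfolding maximal_ideal_def
  proof (intro conjI allI impI)
    fix J assume J: "module.subspace (*) J \<and> N \<subseteq> J"
    show "J = N \<or> J = UNIV"
    proof (rule disjCI)
      assume "J \<noteq> UNIV"
      with J N have "dim J \<le> dim N" by (intro max) auto
      with J N show "J = N"
        using subspace_dim_equal[of N J] subspace_of_ideal by blast
    qed
  qed (use N in auto)
  then have "N = M" by (rule maximal_ideal_unique)
  with N have "x * 1 \<in> M" by blast
  with assms show False by simp
qed

lemma unit_one_plus:
  assumes "v \<in> M" obtains y where "(1 + v) * y = 1"
proof -
  have "1 + v \<notin> M" using assms one_notin_M diff_in_M[of "1 + v" v] by auto
  then show ?thesis using that unit_if_notin_M by blast
qed

text \<open>A form of Nakayama's lemma: the two ideals coincide, so \<open>x = x * v * b\<close> for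
  some \<open>b\<close>, and \<open>1 - v * b\<close> is a unit because \<open>v * b\<close> lies in
  \<open>M\<close>.\<close>

lemma principal_stationary:
  assumes "dim (range ((*) x)) \<le> dim (range ((*) (x * v)))" "v \<in> M"
  shows "x = 0"
proof -
  have "range ((*) (x * v)) \<subseteq> range ((*) x)" by (auto simp: mult.assoc)
  then have "range ((*) (x * v)) = range ((*) x)"
    using assms subspace_dim_equal subspace_of_ideal[OF ideal_principal] by blast
  then obtain b where b: "x * 1 = x * v * b" by (metis imageE rangeI)
  obtain y where y: "(1 + v * - b) * y = 1"
    using unit_one_plus[of "v * - b"] assms(2) by blast
  have "x * (1 + v * - b) = 0" using b by (simp add: algebra_simps)
  then have "x * ((1 + v * - b) * y) = 0" by (simp only: mult.assoc[symmetric] mult_zero_left)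
  then show ?thesis unfolding y by simp
qed

text \<open>At an exponent \<open>k\<close> where the ideal of \<open>x ^ k\<close> has least
  dimension, one more factor \<open>x\<close> cannot shrink it, so
  \<open>principal_stationary\<close> applies.\<close>

lemma nilpotent:
  assumes "x \<in> M" obtains N where "x ^ N = 0"
proof -
  let ?d = "\<lambda>k. dim (range ((*) (x ^ k)))"
  obtain k where "\<And>j. ?d k \<le> ?d j"
    using ex_has_least_nat[of "\<lambda>_. True" 0 ?d] by blast
  then have "x ^ k = 0"
    using principal_stationary[of "x ^ k" x] assms by (metis power_Suc2)
  then show ?thesis using that by blast
qed

text \<open>Take a nonzero multiple of \<open>z\<close> whose ideal has least dimension: a further
  factor from \<open>M\<close> must lower the dimension or give 0. Hence every nonzero ideal inside
  \<open>M\<close> meets the annihilator nontrivially.\<close>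

lemma multiple_in_Ann:
  assumes "z \<in> M" "z \<noteq> 0" obtains a where "z * a \<in> Ann M" "z * a \<noteq> 0"
proof -
  let ?P = "\<lambda>a. z * a \<noteq> 0" and ?d = "\<lambda>a. dim (range ((*) (z * a)))"
  have "?P 1" using assms by simp
  from ex_has_least_nat[of ?P, OF this, of ?d]
  obtain a where a: "?P a" "\<And>b. ?P b \<Longrightarrow> ?d a \<le> ?d b" by blast
  have "z * a * v = 0" if "v \<in> M" for v
  proof (rule ccontr)
    assume "z * a * v \<noteq> 0"
    then have "?d a \<le> dim (range ((*) (z * a * v)))"
      using a(2)[of "a * v"] by (simp add: mult.assoc)
    then show False using principal_stationary that a(1) by blast
  qed
  then have "z * a \<in> Ann M" unfolding Ann_def using assms by blast
  with a that show ?thesis by blast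
qed

lemma in_Ann_in_M: "a \<in> Ann M \<Longrightarrow> a \<in> M"
  unfolding Ann_def by blast

lemma Ann_mult: "a \<in> Ann M \<Longrightarrow> v \<in> M \<Longrightarrow> a * v = 0" "a \<in> Ann M \<Longrightarrow> v \<in> M \<Longrightarrow> v * a = 0"
  unfolding Ann_def by (auto simp: mult.commute)

lemma ideal_Ann: "module.subspace (*) (Ann M)"
  unfolding subspace_mult_iff Ann_def
  by (auto simp: distrib_right mult.assoc)

lemma subspace_Ann: "subspace (Ann M)"
  using ideal_Ann subspace_of_ideal by blast

lemma Ann_span_singleton:
  obtains s where "s \<in> Ann M" "s \<noteq> 0" "Ann M = span {s}"
proof -
  have "\<not> Ann M \<subseteq> {0}"
    using dim_Ann by (metis dim_eq_0 zero_neq_one)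
  then obtain s where s: "s \<in> Ann M" "s \<noteq> 0" by auto
  have "dim (span {s}) = 1"
    using s by (simp add: dim_insert dim_span)
  then have "span {s} = Ann M"
    using s subspace_Ann dim_Ann
    by (intro subspace_dim_equal) (auto simp: span_minimal)
  with s that show ?thesis by metis
qed

section \<open>Power series, exponential and logarithm at nilpotent elements\<close>

lemma scale_mult_scale: "scale a x * scale b y = scale (a * b) (x * y)"
  by (metis scale_mult_left scale_mult_right scale_scale)

lemma of_nat_mult_eq_scale: "of_nat n * x = scale (of_nat n) x"
  by (induction n) (simp_all add: distrib_right scale_left_distrib)

text \<open>Restricting to nonzero powers avoids the choice of a bound on the nilpotency order. If
  \<open>u\<close> is not nilpotent, the index set is infinite and the sum has its default value
  0.\<close>

definition fps_eval :: "'f fps \<Rightarrow> 'a \<Rightarrow> 'a" where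
  "fps_eval f u = (\<Sum>n | u ^ n \<noteq> 0. scale (f $ n) (u ^ n))"

lemma power_eq_0_mono: "x ^ N = 0 \<Longrightarrow> N \<le> n \<Longrightarrow> x ^ n = (0 :: 'a)"
  by (metis le_add_diff_inverse mult_zero_left power_add)

lemma fps_eval_eq_sum:
  assumes "u ^ N = 0" shows "fps_eval f u = (\<Sum>n<N. scale (f $ n) (u ^ n))"
  unfolding fps_eval_def
  by (rule sum.mono_neutral_left) (use power_eq_0_mono[OF assms] not_less in auto)

lemma fps_eval_in_M:
  assumes "u \<in> M" "f $ 0 = 0" shows "fps_eval f u \<in> M"
  unfolding fps_eval_def
proof (rule subspace_sum[OF subspace_M])
  fix n show "scale (f $ n) (u ^ n) \<in> M"
    using assms by (cases n) auto
qed

lemma fps_eval_mult: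
  assumes "u \<in> M" shows "fps_eval (f * g) u = fps_eval f u * fps_eval g u"
proof -
  obtain N where N: "u ^ N = 0" using nilpotent assms by blast
  have "fps_eval f u * fps_eval g u =
      (\<Sum>k<N. \<Sum>i\<le>k. scale (f $ i) (u ^ i) * scale (g $ (k - i)) (u ^ (k - i)))"
    unfolding fps_eval_eq_sum[OF N]
    by (rule sum_mult_sum_eq_triangle)
       (simp add: scale_mult_scale power_eq_0_mono[OF N] flip: power_add)
  also have "\<dots> = (\<Sum>k<N. scale ((f * g) $ k) (u ^ k))"
    by (intro sum.cong refl)
       (simp add: fps_mult_nth scale_sum_left scale_mult_scale atMost_atLeast0 flip: power_add)
  finally show ?thesis unfolding fps_eval_eq_sum[OF N] by simp
qed

lemma fps_eval_1: assumes "u \<in> M" shows "fps_eval 1 u = 1"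
proof -
  obtain N where N: "u ^ N = 0" using nilpotent assms by blast
  \<comment> \<open>A successor bound lets the constant term be split off the truncated sum.\<close>
  then have "u ^ Suc N = 0" by simp
  from fps_eval_eq_sum[OF this, of 1] show ?thesis
    by (subst (asm) sum.lessThan_Suc_shift) simp
qed

lemma fps_eval_X: assumes "u \<in> M" shows "fps_eval fps_X u = u"
proof -
  obtain N where N: "u ^ N = 0" using nilpotent assms by blast
  then have "u ^ Suc (Suc N) = 0" by simp
  from fps_eval_eq_sum[OF this, of fps_X] show ?thesis
    by (simp only: sum.lessThan_Suc_shift) (simp add: fps_X_def)
qed

lemma fps_eval_power:
  assumes "u \<in> M" shows "fps_eval (f ^ n) u = fps_eval f u ^ n"
  by (induction n) (simp_all add: fps_eval_1 fps_eval_mult assms)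

lemma fps_eval_diff: "fps_eval (f - g) u = fps_eval f u - fps_eval g u"
  unfolding fps_eval_def by (simp add: scale_left_diff_distrib sum_subtractf)

text \<open>As \<open>g\<close> has no constant term, \<open>g ^ i\<close> has no terms below degree
  \<open>i\<close>. So one bound \<open>N\<close> truncates the inner and the outer series, and only
  an interchange of finite sums remains.\<close>

lemma fps_eval_compose:
  assumes u: "u \<in> M" and g: "g $ 0 = 0"
  shows "fps_eval (f oo g) u = fps_eval f (fps_eval g u)"
proof -
  obtain N where N: "u ^ N = 0" using nilpotent u by blast
  note prefix = startsby_zero_power_prefix[OF g, rule_format]
  have "fps_eval (g ^ N) u = 0"
    unfolding fps_eval_eq_sum[OF N] by (simp add: prefix)
  then have "fps_eval f (fps_eval g u) = (\<Sum>i<N. scale (f $ i) (fps_eval (g ^ i) u))"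
    by (simp add: fps_eval_eq_sum[of _ N] fps_eval_power[OF u])
  also have "\<dots> = (\<Sum>i<N. \<Sum>n<N. scale (f $ i * (g ^ i) $ n) (u ^ n))"
    unfolding fps_eval_eq_sum[OF N] by (simp add: scale_sum_right)
  also have "\<dots> = (\<Sum>n<N. \<Sum>i<N. scale (f $ i * (g ^ i) $ n) (u ^ n))"
    by (rule sum.swap)
  also have "\<dots> = (\<Sum>n<N. scale ((f oo g) $ n) (u ^ n))"
  proof (rule sum.cong[OF refl])
    fix n assume "n \<in> {..<N}"
    then have "(\<Sum>i<N. scale (f $ i * (g ^ i) $ n) (u ^ n)) =
        (\<Sum>i=0..n. scale (f $ i * (g ^ i) $ n) (u ^ n))"
      by (intro sum.mono_neutral_right) (auto simp: prefix)
    then show "(\<Sum>i<N. scale (f $ i * (g ^ i) $ n) (u ^ n)) = scale ((f oo g) $ n) (u ^ n)"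
      by (simp add: fps_compose_nth scale_sum_left)
  qed
  finally show ?thesis unfolding fps_eval_eq_sum[OF N] by simp
qed

definition expo :: "'a \<Rightarrow> 'a" where
  "expo u = fps_eval (fps_exp 1) u"

lemma expo_add:
  assumes "x \<in> M" "y \<in> M" shows "expo (x + y) = expo x * expo y"
proof -
  obtain a b where a: "x ^ a = 0" and b: "y ^ b = 0" using nilpotent assms by metis
  \<comment> \<open>With this bound every \<open>x ^ i * y ^ j\<close> of total degree at least
    \<open>N\<close> vanishes, which truncates the product of the two series and also gives
    \<open>(x + y) ^ N = 0\<close>.\<close>
  define N where "N = a + b"
  have xN: "x ^ N = 0" and yN: "y ^ N = 0"
    using power_eq_0_mono a b unfolding N_def by auto
  have xy: "x ^ i * y ^ j = 0" if "N \<le> i + j" for i j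
  proof -
    have "a \<le> i \<or> b \<le> j" using that unfolding N_def by linarith
    then show ?thesis using power_eq_0_mono[OF a] power_eq_0_mono[OF b] by auto
  qed
  have "(x + y) ^ N = 0"
    unfolding binomial_ring by (rule sum.neutral) (auto simp: xy mult.assoc)
  have "expo x * expo y =
      (\<Sum>k<N. \<Sum>i\<le>k. scale (1 / fact i) (x ^ i) * scale (1 / fact (k - i)) (y ^ (k - i)))"
    unfolding expo_def fps_eval_eq_sum[OF xN] fps_eval_eq_sum[OF yN]
    by (subst sum_mult_sum_eq_triangle) (simp_all add: scale_mult_scale xy)
  also have "\<dots> = (\<Sum>k<N. scale (1 / fact k) ((x + y) ^ k))"
  proof (rule sum.cong[OF refl])
    fix k
    have "scale (1 / fact k) (of_nat (k choose i) * x ^ i * y ^ (k - i)) =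
        scale (1 / fact i) (x ^ i) * scale (1 / fact (k - i)) (y ^ (k - i))" if "i \<le> k" for i
    proof -
      have "1 / fact k * of_nat (k choose i) = 1 / fact i * (1 / fact (k - i) :: 'f)"
        using that by (simp add: binomial_fact)
      then show ?thesis
        unfolding mult.assoc by (simp only: of_nat_mult_eq_scale scale_mult_scale scale_scale)
    qed
    then show "(\<Sum>i\<le>k. scale (1 / fact i) (x ^ i) * scale (1 / fact (k - i)) (y ^ (k - i))) =
        scale (1 / fact k) ((x + y) ^ k)"
      unfolding binomial_ring by (simp add: scale_sum_right)
  qed
  also have "\<dots> = expo (x + y)"
    unfolding expo_def fps_eval_eq_sum[OF \<open>(x + y) ^ N = 0\<close>] by simp
  finally show ?thesis by simp
qed

lemma expo_minus_1: "u \<in> M \<Longrightarrow> expo u - 1 = fps_eval (fps_exp 1 - 1) u"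
  by (simp add: expo_def fps_eval_diff fps_eval_1)

lemma expo_minus_1_in_M: "u \<in> M \<Longrightarrow> expo u - 1 \<in> M"
  by (simp add: expo_minus_1 fps_eval_in_M)

lemma expo_square_minus_1_in_M:
  assumes "u \<in> M" shows "(expo u)\<^sup>2 - 1 \<in> M"
proof -
  have "(expo u)\<^sup>2 - 1 = (expo u + 1) * (expo u - 1)"
    by (simp add: power2_eq_square algebra_simps)
  then show ?thesis using assms by (simp add: expo_minus_1_in_M mult_in_M)
qed

text \<open>The formal series \<open>fps_ln 1\<close> makes both inversion laws below instances of
  composition of formal power series. Index 0 drops out because its coefficient is 0.\<close>

lemma log_one_plus_eq:
  assumes "u \<in> M" shows "log_one_plus scale u = fps_eval (fps_ln 1) u"
proof -
  obtain N where N: "u ^ N = 0" using nilpotent assms by blast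
  have "{m. u ^ m \<noteq> 0} \<subseteq> {..<N}" using power_eq_0_mono[OF N] not_less by auto
  then have "finite {m. u ^ m \<noteq> 0}" using finite_subset by blast
  then have "fps_eval (fps_ln 1) u =
      (\<Sum>m | 1 \<le> m \<and> u ^ m \<noteq> 0. scale (fps_ln 1 $ m) (u ^ m))"
    unfolding fps_eval_def by (intro sum.mono_neutral_right)
      (auto simp: Suc_le_eq fps_ln_nth split: if_splits)
  also have "\<dots> = log_one_plus scale u"
    unfolding log_one_plus_def by (rule sum.cong) (auto simp: fps_ln_nth Suc_le_eq gr0_conv_Suc)
  finally show ?thesis by simp
qed

lemma log_in_M: "u \<in> M \<Longrightarrow> log_one_plus scale u \<in> M"
  by (simp add: log_one_plus_eq fps_eval_in_M)

lemma expo_log: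
  assumes "u \<in> M" shows "expo (log_one_plus scale u) = 1 + u"
proof -
  have "expo (log_one_plus scale u) - 1 = fps_eval ((fps_exp 1 - 1) oo fps_ln 1) u"
    using assms by (simp add: expo_minus_1 log_in_M fps_eval_compose flip: log_one_plus_eq)
  also have "\<dots> = u"
    by (simp add: fps_ln_fps_exp_inv fps_inv_fps_exp_compose fps_eval_X assms)
  finally show ?thesis by (simp add: algebra_simps)
qed

lemma log_expo:
  assumes "v \<in> M" shows "log_one_plus scale (expo v - 1) = v"
proof -
  have "log_one_plus scale (expo v - 1) = fps_eval (fps_ln 1 oo (fps_exp 1 - 1)) v"
    using assms by (simp add: log_one_plus_eq fps_eval_in_M expo_minus_1 fps_eval_compose)
  also have "\<dots> = v"
    by (simp add: fps_ln_fps_exp_inv fps_inv_fps_exp_compose fps_eval_X assms)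
  finally show ?thesis .
qed

section \<open>Admissible projections, their hypersurfaces and translates\<close>

context
  fixes \<rho> :: "'a \<Rightarrow> 'a"
  assumes \<rho>: "admissible_projection scale M \<rho>"
begin

lemma proj_in_Ann: "v \<in> M \<Longrightarrow> \<rho> v \<in> Ann M"
  using \<rho> unfolding admissible_projection_def by blast

lemma proj_in_M: "v \<in> M \<Longrightarrow> \<rho> v \<in> M"
  using proj_in_Ann in_Ann_in_M by blast

lemma proj_Ann: "a \<in> Ann M \<Longrightarrow> \<rho> a = a"
  using \<rho> unfolding admissible_projection_def by force

lemma proj_add: "u \<in> M \<Longrightarrow> v \<in> M \<Longrightarrow> \<rho> (u + v) = \<rho> u + \<rho> v"
  using \<rho> unfolding admissible_projection_def linear_endo_def by blast

lemma proj_scale: "u \<in> M \<Longrightarrow> \<rho> (scale c u) = scale c (\<rho> u)"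
  using \<rho> unfolding admissible_projection_def linear_endo_def by blast

lemma proj_0: "\<rho> 0 = 0"
  using proj_add[of 0 0] by simp

lemma proj_diff: "u \<in> M \<Longrightarrow> v \<in> M \<Longrightarrow> \<rho> (u - v) = \<rho> u - \<rho> v"
  using proj_add[of "u - v" v] by (simp add: diff_in_M)

text \<open>An element \<open>u\<close> of \<open>M\<close> outside the annihilator has a nonzero
  multiple \<open>u * v * a\<close> inside it with \<open>v\<close> in \<open>M\<close>, and
  \<open>\<rho>\<close> fixes that multiple.\<close>

lemma proj_nondegenerate:
  assumes u: "u \<in> M" and zero: "\<And>v. v \<in> M \<Longrightarrow> \<rho> (u * v) = 0"
  shows "u \<in> Ann M"
proof (rule ccontr)
  assume "u \<notin> Ann M"
  then obtain v where v: "v \<in> M" "u * v \<noteq> 0" using u unfolding Ann_def by blast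
  then obtain a where "u * v * a \<in> Ann M" "u * v * a \<noteq> 0"
    using multiple_in_Ann[of "u * v"] by blast
  moreover have "\<rho> (u * (v * a)) = 0" using v zero by blast
  ultimately show False using proj_Ann by (simp add: mult.assoc)
qed

text \<open>If \<open>expo x = 1 + u\<close>, then the quadratic expression in \<open>u\<close> is
  \<open>(expo x)\<^sup>2 - 1\<close>. From here on the hypersurface is the zero set of this
  defining function, exp(2x) - 1 followed by \<open>\<rho>\<close>.\<close>

lemma hypersurface_iff:
  "x \<in> hypersurface scale M \<rho> \<longleftrightarrow> x \<in> M \<and> \<rho> ((expo x)\<^sup>2 - 1) = 0"
proof
  assume "x \<in> hypersurface scale M \<rho>"
  then obtain u where u: "u \<in> M" "\<rho> (2 * u + u\<^sup>2) = 0" "x = log_one_plus scale u"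
    unfolding hypersurface_def affine_quadric_def by blast
  have "(expo x)\<^sup>2 - 1 = 2 * u + u\<^sup>2"
    using u by (simp add: expo_log power2_eq_square algebra_simps)
  with u log_in_M show "x \<in> M \<and> \<rho> ((expo x)\<^sup>2 - 1) = 0" by simp
next
  assume x: "x \<in> M \<and> \<rho> ((expo x)\<^sup>2 - 1) = 0"
  have "(expo x)\<^sup>2 - 1 = 2 * (expo x - 1) + (expo x - 1)\<^sup>2"
    by (simp add: power2_eq_square algebra_simps)
  with x have "\<rho> (2 * (expo x - 1) + (expo x - 1)\<^sup>2) = 0" by (simp only:)
  then have "expo x - 1 \<in> affine_quadric M \<rho>"
    unfolding affine_quadric_def using x expo_minus_1_in_M by blast
  moreover have "x = log_one_plus scale (expo x - 1)"
    using x by (simp add: log_expo)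
  ultimately show "x \<in> hypersurface scale M \<rho>" unfolding hypersurface_def by blast
qed

end

lemma expo_mult_Ann:
  assumes "y \<in> M" "a \<in> Ann M" shows "expo y * a = a"
proof -
  have "(expo y - 1) * a = 0" using assms Ann_mult expo_minus_1_in_M by blast
  then show ?thesis by (simp add: algebra_simps)
qed

definition twist :: "('a \<Rightarrow> 'a) \<Rightarrow> 'a \<Rightarrow> 'a \<Rightarrow> 'a" where
  "twist \<rho> y v = \<rho> ((expo y)\<^sup>2 * v)"

text \<open>The factor exp(2y) is 1 plus an element of \<open>M\<close>, so it acts as the identity
  on the annihilator.\<close>

lemma twist_admissible:
  assumes \<rho>: "admissible_projection scale M \<rho>" and y: "y \<in> M"
  shows "admissible_projection scale M (twist \<rho> y)"
proof -
  have Ann: "twist \<rho> y a = a" if "a \<in> Ann M" for a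
    unfolding twist_def using y that by (simp add: power2_eq_square mult.assoc expo_mult_Ann proj_Ann[OF \<rho>])
  have in_Ann: "twist \<rho> y v \<in> Ann M" if "v \<in> M" for v
    unfolding twist_def using that proj_in_Ann[OF \<rho>] by blast
  have "twist \<rho> y ` M = Ann M"
    using Ann in_Ann in_Ann_in_M by (metis image_subset_iff rev_image_eqI subsetI subset_antisym)
  then show ?thesis
    unfolding admissible_projection_def linear_endo_def
    using Ann in_Ann in_Ann_in_M
    by (auto simp: twist_def distrib_left proj_add[OF \<rho>] mult_in_M proj_scale[OF \<rho>]
        simp flip: scale_mult_right)
qed

text \<open>exp(2(x + y)) - 1 is exp(2y) (exp(2x) - 1) plus exp(2y) - 1, and \<open>\<rho>\<close>
  kills the last summand because \<open>y\<close> lies on the hypersurface.\<close>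

lemma hypersurface_twist_iff:
  assumes \<rho>: "admissible_projection scale M \<rho>"
    and y: "y \<in> hypersurface scale M \<rho>" and x: "x \<in> M"
  shows "x \<in> hypersurface scale M (twist \<rho> y) \<longleftrightarrow> x + y \<in> hypersurface scale M \<rho>"
proof -
  have yM: "y \<in> M" and y0: "\<rho> ((expo y)\<^sup>2 - 1) = 0"
    using y hypersurface_iff[OF \<rho>] by auto
  have "(expo (x + y))\<^sup>2 - 1 = (expo y)\<^sup>2 * ((expo x)\<^sup>2 - 1) + ((expo y)\<^sup>2 - 1)"
    using x yM by (simp add: expo_add power_mult_distrib algebra_simps)
  then have "\<rho> ((expo (x + y))\<^sup>2 - 1) =
      twist \<rho> y ((expo x)\<^sup>2 - 1) + \<rho> ((expo y)\<^sup>2 - 1)"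
    unfolding twist_def using x yM
    by (simp only: proj_add[OF \<rho>] expo_square_minus_1_in_M mult_in_M)
  then show ?thesis
    using x yM by (simp add: hypersurface_iff \<rho> twist_admissible add_in_M y0)
qed

section \<open>Complementary hyperplanes as kernels of twisted projections\<close>

definition kernel :: "('a \<Rightarrow> 'a) \<Rightarrow> 'a set" where
  "kernel \<rho> = {v \<in> M. \<rho> v = 0}"

lemma kernel_complementary:
  assumes \<rho>: "admissible_projection scale M \<rho>"
  shows "kernel \<rho> \<in> complementary_hyperplanes scale M"
proof -
  have sub: "subspace (kernel \<rho>)"
    unfolding subspace_def kernel_def
    by (auto simp: proj_0[OF \<rho>] proj_add[OF \<rho>] proj_scale[OF \<rho>])
  have int: "kernel \<rho> \<inter> Ann M = {0}"
    using subspace_0[OF sub] subspace_0[OF subspace_Ann] proj_Ann[OF \<rho>]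
    unfolding kernel_def by auto
  have "v \<in> {h + a |h a. h \<in> kernel \<rho> \<and> a \<in> Ann M}" if "v \<in> M" for v
  proof -
    have "v - \<rho> v \<in> kernel \<rho>"
      using that by (simp add: kernel_def diff_in_M proj_in_M[OF \<rho>] proj_diff[OF \<rho>]
          proj_Ann[OF \<rho>] proj_in_Ann[OF \<rho>])
    moreover have "v = v - \<rho> v + \<rho> v" by simp
    ultimately show ?thesis using that proj_in_Ann[OF \<rho>] by blast
  qed
  then have sum: "{h + a |h a. h \<in> kernel \<rho> \<and> a \<in> Ann M} = M"
    using in_Ann_in_M by (auto simp: kernel_def)
  have "dim M = dim (kernel \<rho>) + 1"
    using dim_sums_Int[OF sub subspace_Ann] unfolding sum int dim_Ann by simp
  then show ?thesis
    unfolding complementary_hyperplanes_def using sub int sum kernel_def by auto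
qed

text \<open>\<open>Ann M\<close> is a line, so \<open>f\<close> amounts to a linear functional: its
  zeros in \<open>U\<close> together with one vector \<open>u0\<close> where it is nonzero span
  \<open>U\<close>.\<close>

lemma dim_le_dim_kernel:
  assumes "subspace U" and add: "\<And>x y. f (x + y) = f x + f y"
    and hom: "\<And>c x. f (scale c x) = scale c (f x)" and Ann: "\<And>x. f x \<in> Ann M"
  shows "dim U \<le> dim {u \<in> U. f u = 0} + 1"
proof (cases "\<forall>u\<in>U. f u = 0")
  case True
  then have "{u \<in> U. f u = 0} = U" by blast
  then show ?thesis by simp
next
  case False
  then obtain u0 where u0: "u0 \<in> U" "f u0 \<noteq> 0" by blast
  obtain s where s: "Ann M = span {s}" by (rule Ann_span_singleton)
  obtain c0 where c0: "f u0 = scale c0 s" using Ann s by (auto simp: span_singleton)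
  with u0 have "c0 \<noteq> 0" by auto
  have diff: "f (x - y) = f x - f y" for x y
    using add[of "x - y" y] by simp
  have "u \<in> span (insert u0 {u \<in> U. f u = 0})" if u: "u \<in> U" for u
  proof -
    obtain c where c: "f u = scale c s" using Ann s by (auto simp: span_singleton)
    have "f (u - scale (c / c0) u0) = 0"
      using c c0 \<open>c0 \<noteq> 0\<close> by (simp add: diff hom)
    then have "u - scale (c / c0) u0 \<in> {u \<in> U. f u = 0}"
      using u u0 \<open>subspace U\<close> by (simp add: subspace_diff subspace_scale)
    then have "u - scale (c / c0) u0 \<in> span {u \<in> U. f u = 0}" by (rule span_base)
    then show ?thesis unfolding span_insert mem_Collect_eq by (rule exI)
  qed
  then have "U \<subseteq> span (insert u0 {u \<in> U. f u = 0})" by (rule subsetI)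
  then have "dim U \<le> dim (insert u0 {u \<in> U. f u = 0})" by (rule dim_mono)
  also have "\<dots> \<le> dim {u \<in> U. f u = 0} + 1" by (simp add: dim_insert)
  finally show ?thesis .
qed

text \<open>Induction on \<open>B\<close> imposes one condition at a time, each costing at most one
  dimension. Here \<open>z\<close> ranges over the whole algebra and not only over \<open>M\<close>,
  since a unit is sought.\<close>

lemma dim_le_dim_joint_kernel:
  assumes "finite B" and \<rho>: "admissible_projection scale M \<rho>" and "B \<subseteq> M"
  shows "dim (UNIV :: 'a set) \<le> dim {z. \<forall>h\<in>B. \<rho> (z * h) = 0} + card B"
  using \<open>finite B\<close> \<open>B \<subseteq> M\<close>
proof (induction B)
  case (insert b B)
  let ?U = "{z. \<forall>h\<in>B. \<rho> (z * h) = 0}"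
  have add: "\<rho> ((x + y) * h) = \<rho> (x * h) + \<rho> (y * h)" if "h \<in> M" for x y h
    using that by (simp add: distrib_right proj_add[OF \<rho>] mult_in_M)
  have hom: "\<rho> (scale c x * h) = scale c (\<rho> (x * h))" if "h \<in> M" for c x h
    using that by (simp add: proj_scale[OF \<rho>] mult_in_M flip: scale_mult_left)
  have "subspace ?U"
    unfolding subspace_def using insert.prems
    by (auto simp: add hom proj_0[OF \<rho>] subset_eq)
  then have "dim ?U \<le> dim {u \<in> ?U. \<rho> (u * b) = 0} + 1"
    using insert.prems by (intro dim_le_dim_kernel) (auto simp: add hom intro!: proj_in_Ann[OF \<rho>])
  also have "{u \<in> ?U. \<rho> (u * b) = 0} = {z. \<forall>h\<in>insert b B. \<rho> (z * h) = 0}" by auto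
  finally show ?case using insert by simp
qed simp

text \<open>Multiplication by \<open>z\<close> maps the line \<open>Ann M\<close> to itself, so it
  is a scalar there, nonzero because \<open>z\<close> is a unit.\<close>

lemma scalar_on_Ann:
  assumes "z \<notin> M" obtains c where "c \<noteq> 0" "\<And>a. a \<in> Ann M \<Longrightarrow> z * a = scale c a"
proof -
  obtain s where s: "s \<in> Ann M" "s \<noteq> 0" "Ann M = span {s}" by (rule Ann_span_singleton)
  have "z * s \<in> Ann M" using ideal_Ann s(1) unfolding subspace_mult_iff by blast
  then obtain c where c: "z * s = scale c s" using s by (auto simp: span_singleton)
  obtain y where "z * y = 1" using unit_if_notin_M[OF assms] .
  then have "y * (z * s) = s" by (metis mult.assoc mult.commute mult_1)
  with s(2) have "z * s \<noteq> 0" by auto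
  with c have "c \<noteq> 0" by auto
  moreover have "z * a = scale c a" if "a \<in> Ann M" for a
  proof -
    obtain d where "a = scale d s" using \<open>a \<in> Ann M\<close> s(3) by (auto simp: span_singleton)
    then show ?thesis using c by (simp add: scale_left_commute flip: scale_mult_right)
  qed
  ultimately show ?thesis using that by blast
qed

text \<open>Half the logarithm of \<open>1 + u\<close> solves exp(2y) = 1 + u. Choosing
  \<open>u = w - \<rho> w\<close> gives \<open>\<rho> u = 0\<close>, which puts \<open>y\<close> on
  the hypersurface, and leaves products with \<open>M\<close> unchanged because
  \<open>\<rho> w\<close> annihilates \<open>M\<close>.\<close>

lemma point_with_twist:
  assumes \<rho>: "admissible_projection scale M \<rho>" and wM: "w \<in> M"
  obtains y where "y \<in> hypersurface scale M \<rho>"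
    "\<And>v. v \<in> M \<Longrightarrow> twist \<rho> y v = \<rho> ((1 + w) * v)"
proof -
  define u where "u = w - \<rho> w"
  have uM: "u \<in> M" unfolding u_def using wM proj_in_M[OF \<rho>] by blast
  define y where "y = scale (1 / 2) (log_one_plus scale u)"
  have yM: "y \<in> M" unfolding y_def using log_in_M uM by blast
  have "y + y = log_one_plus scale u"
    unfolding y_def scale_left_distrib[symmetric] by simp
  then have y: "(expo y)\<^sup>2 = 1 + u"
    unfolding power2_eq_square expo_add[OF yM yM, symmetric] by (simp only: expo_log uM)
  have "\<rho> u = 0"
    unfolding u_def using wM
    by (simp add: proj_diff[OF \<rho>] proj_in_M[OF \<rho>] proj_in_Ann[OF \<rho>] proj_Ann[OF \<rho>])
  then have "y \<in> hypersurface scale M \<rho>"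
    by (simp add: hypersurface_iff[OF \<rho>] y yM)
  moreover have "twist \<rho> y v = \<rho> ((1 + w) * v)" if "v \<in> M" for v
  proof -
    have "(1 + u) * v = (1 + w) * v - \<rho> w * v" unfolding u_def by (simp add: algebra_simps)
    then show ?thesis
      using Ann_mult(1)[OF proj_in_Ann[OF \<rho> wM] that] by (simp add: twist_def y)
  qed
  ultimately show ?thesis using that by blast
qed

text \<open>
  The conditions \<open>\<pi> (z * h) = 0\<close> for \<open>h\<close> in a hyperplane \<open>H\<close> leave at least two dimensions for
  \<open>z\<close>, hence a solution outside the annihilator. Nondegeneracy makes that solution a unit, and
  rescaled to act as the identity on the annihilator it is of the form \<open>1 + w\<close>.
\<close>

lemma complementary_hyperplane_is_kernel:
  assumes \<pi>: "admissible_projection scale M \<pi>"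
    and H: "H \<in> complementary_hyperplanes scale M"
  obtains y where "y \<in> hypersurface scale M \<pi>" "kernel (twist \<pi> y) = H"
proof -
  have H: "subspace H" "H \<subseteq> M" "dim M = dim H + 1" "H \<inter> Ann M = {0}"
    "{h + a | h a. h \<in> H \<and> a \<in> Ann M} = M"
    using H unfolding complementary_hyperplanes_def by auto
  obtain B where B: "B \<subseteq> H" "independent B" "H \<subseteq> span B" "card B = dim H"
    using basis_exists by blast
  let ?K = "{z. \<forall>h\<in>B. \<pi> (z * h) = 0}"
  have BM: "B \<subseteq> M" using B H by blast
  have "M \<subset> UNIV" using one_notin_M by blast
  then have "dim M < dim (UNIV :: 'a set)"
    by (intro dim_psubset) (simp add: span_eq_iff[THEN iffD2, OF subspace_M])
  moreover have "dim (UNIV :: 'a set) \<le> dim ?K + dim H"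
    using dim_le_dim_joint_kernel[OF finiteI_independent[OF B(2)] \<pi> BM] by (simp only: B(4))
  ultimately have "dim (Ann M) < dim ?K" using H(3) dim_Ann by simp
  then have "\<not> ?K \<subseteq> Ann M" using dim_subset[of ?K "Ann M"] by linarith
  then obtain z where z: "z \<in> ?K" "z \<notin> Ann M" by blast
  have zH: "\<pi> (z * h) = 0" if "h \<in> H" for h
  proof -
    have "subspace {h \<in> M. \<pi> (z * h) = 0}"
      unfolding subspace_def
      by (auto simp: proj_0[OF \<pi>] distrib_left proj_add[OF \<pi>] mult_in_M proj_scale[OF \<pi>]
          simp flip: scale_mult_right)
    then have "span B \<subseteq> {h \<in> M. \<pi> (z * h) = 0}"
      using z(1) BM by (intro span_minimal) auto
    with B(3) that show ?thesis by blast
  qed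
  have decompose: "\<exists>h a. v = h + a \<and> h \<in> H \<and> a \<in> Ann M" if "v \<in> M" for v
    using H(5) that by blast
  have "z \<notin> M"
  proof
    assume zM: "z \<in> M"
    have "\<pi> (z * v) = 0" if "v \<in> M" for v
    proof -
      obtain h a where ha: "v = h + a" "h \<in> H" "a \<in> Ann M"
        using decompose[OF \<open>v \<in> M\<close>] by blast
      then have "z * v = z * h" using zM by (simp add: distrib_left Ann_mult)
      with ha zH show ?thesis by simp
    qed
    with zM z(2) proj_nondegenerate[OF \<pi>] show False by blast
  qed
  then obtain c where c: "c \<noteq> 0" "\<And>a. a \<in> Ann M \<Longrightarrow> z * a = scale c a"
    using scalar_on_Ann by blast
  define w where "w = scale (1 / c) z - 1"
  have wa: "w * a = 0" if "a \<in> Ann M" for a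
    using that c unfolding w_def by (simp add: left_diff_distrib flip: scale_mult_left)
  \<comment> \<open>A unit could not kill the nonzero annihilator.\<close>
  have wM: "w \<in> M"
  proof (rule ccontr)
    assume "w \<notin> M"
    then obtain y where y: "w * y = 1" using unit_if_notin_M by blast
    obtain s where "s \<in> Ann M" "s \<noteq> 0" using Ann_span_singleton by blast
    then show False using wa y by (metis mult.assoc mult.commute mult_1 mult_zero_right)
  qed
  obtain y where yS: "y \<in> hypersurface scale M \<pi>"
    and y: "\<And>v. v \<in> M \<Longrightarrow> twist \<pi> y v = \<pi> ((1 + w) * v)"
    using point_with_twist[OF \<pi> wM] by blast
  have yM: "y \<in> M" using yS hypersurface_iff[OF \<pi>] by blast
  have twist_H: "twist \<pi> y h = 0" if "h \<in> H" for h
  proof -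
    have hM: "h \<in> M" using \<open>h \<in> H\<close> H(2) by blast
    have "(1 + w) * h = scale (1 / c) (z * h)" by (simp add: w_def scale_mult_left)
    then show ?thesis
      using zH[OF \<open>h \<in> H\<close>] hM by (simp add: y proj_scale[OF \<pi>] mult_in_M)
  qed
  note tw = twist_admissible[OF \<pi> yM]
  have "v \<in> H" if "v \<in> M" "twist \<pi> y v = 0" for v
  proof -
    obtain h a where ha: "v = h + a" "h \<in> H" "a \<in> Ann M"
      using decompose[OF \<open>v \<in> M\<close>] by blast
    then have "twist \<pi> y v = a"
      using H(2) by (auto simp: proj_add[OF tw] in_Ann_in_M proj_Ann[OF tw] twist_H)
    with that ha show ?thesis by simp
  qed
  then have "kernel (twist \<pi> y) = H" unfolding kernel_def using twist_H H(2) by blast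
  with yS that show ?thesis by blast
qed

section \<open>Linear maps on the maximal ideal, and polynomials with vector coefficients\<close>

lemma linear_endo_0: "linear_endo scale M L \<Longrightarrow> L 0 = 0"
  unfolding linear_endo_def by (metis add_cancel_right_right zero_in_M)

lemma linear_endo_in_M: "linear_endo scale M L \<Longrightarrow> x \<in> M \<Longrightarrow> L x \<in> M"
  unfolding linear_endo_def by blast

lemma linear_endo_add:
  "linear_endo scale M L \<Longrightarrow> x \<in> M \<Longrightarrow> y \<in> M \<Longrightarrow> L (x + y) = L x + L y"
  unfolding linear_endo_def by blast

lemma linear_endo_scale: "linear_endo scale M L \<Longrightarrow> x \<in> M \<Longrightarrow> L (scale c x) = scale c (L x)"
  unfolding linear_endo_def by blast

lemma linear_endo_diff:
  "linear_endo scale M L \<Longrightarrow> x \<in> M \<Longrightarrow> y \<in> M \<Longrightarrow> L (x - y) = L x - L y"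
  using linear_endo_add[of L "x - y" y] by (simp add: diff_in_M)

lemma linear_endo_sum:
  assumes "linear_endo scale M L" "finite I" "\<And>i. i \<in> I \<Longrightarrow> g i \<in> M"
  shows "L (\<Sum>i\<in>I. g i) = (\<Sum>i\<in>I. L (g i))"
  using assms(2,3)
proof (induction I)
  case (insert i I)
  then have "(\<Sum>i\<in>I. g i) \<in> M" by (intro subspace_sum[OF subspace_M]) blast
  with insert show ?case by (simp add: linear_endo_add[OF assms(1)])
qed (simp add: linear_endo_0[OF assms(1)])

lemma linear_endo_projection: "admissible_projection scale M \<rho> \<Longrightarrow> linear_endo scale M \<rho>"
  unfolding admissible_projection_def by blast

text \<open>Subtracting \<open>2 ^ N\<close> times the value at \<open>t\<close> from the value at
  \<open>2 * t\<close> removes the top coefficient and multiplies the others by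
  \<open>2 ^ j - 2 ^ N\<close>, nonzero in characteristic zero. The top coefficient is then read off
  at \<open>t = 1\<close>.\<close>

lemma vector_polynomial_eq_0:
  assumes "\<And>t. (\<Sum>j<N. scale (t ^ j) (v j)) = 0" and "j < N"
  shows "v j = 0"
  using assms
proof (induction N arbitrary: v j)
  case (Suc N)
  have below: "v i = 0" if "i < N" for i
  proof -
    have "(\<Sum>j<N. scale (t ^ j) (scale (2 ^ j - 2 ^ N) (v j))) = 0" for t
    proof -
      have "(\<Sum>j<Suc N. scale ((2 * t) ^ j) (v j)) - scale (2 ^ N) (\<Sum>j<Suc N. scale (t ^ j) (v j)) = 0"
        by (simp only: Suc.prems(1) scale_zero_right diff_zero)
      then have "(\<Sum>j<Suc N. scale (t ^ j) (scale (2 ^ j - 2 ^ N) (v j))) = 0"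
        by (simp add: scale_sum_right scale_left_diff_distrib scale_right_diff_distrib
            power_mult_distrib mult.commute sum_subtractf del: sum.lessThan_Suc)
      then show ?thesis by simp
    qed
    from Suc.IH[OF this \<open>i < N\<close>] have "scale (2 ^ i - 2 ^ N) (v i) = 0" .
    moreover have "(2 :: 'f) ^ i \<noteq> 2 ^ N"
    proof
      assume "(2 :: 'f) ^ i = 2 ^ N"
      then have "of_nat (2 ^ i) = (of_nat (2 ^ N) :: 'f)" by simp
      then have "(2 :: nat) ^ i = 2 ^ N" unfolding of_nat_eq_iff .
      with \<open>i < N\<close> show False by simp
    qed
    ultimately show ?thesis by simp
  qed
  moreover have "v N = 0" using Suc.prems(1)[of 1] below by simp
  ultimately show ?case using Suc.prems(2) less_Suc_eq by blast
qed simp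

lemma scale_numeral_eq_mult: "scale (numeral k) x = numeral k * x"
  using of_nat_mult_eq_scale[of "numeral k" x] by simp

section \<open>Chords of the hypersurface and the annihilator\<close>

lemma fps_eval_Ann:
  assumes "a \<in> Ann M" "f $ 0 = 0" shows "fps_eval f a = scale (f $ 1) a"
proof -
  have "a ^ 2 = 0" using assms Ann_mult in_Ann_in_M by (simp add: power2_eq_square)
  from fps_eval_eq_sum[OF this] show ?thesis
    using assms by (simp add: numeral_2_eq_2)
qed

lemma expo_Ann: assumes "a \<in> Ann M" shows "expo a = 1 + a"
proof -
  have "expo a - 1 = a"
    using fps_eval_Ann[OF assms, of "fps_exp 1 - 1"] assms
    by (simp add: expo_minus_1[OF in_Ann_in_M])
  then show ?thesis by (simp add: algebra_simps)
qed

text \<open>Since \<open>a * a = 0\<close> and exponentials fix \<open>a\<close>, exp(2(x + a))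
  equals exp(2x) + 2a: along the annihilator the defining function is affine with slope 2.\<close>

lemma proj_expo_add_Ann:
  assumes \<rho>: "admissible_projection scale M \<rho>" and "x \<in> M" "a \<in> Ann M"
  shows "\<rho> ((expo (x + a))\<^sup>2 - 1) = \<rho> ((expo x)\<^sup>2 - 1) + scale 2 a"
proof -
  have "expo x * (expo x * a) = a" and "a * a = 0"
    using assms by (simp_all add: expo_mult_Ann Ann_mult in_Ann_in_M)
  moreover have "(expo (x + a))\<^sup>2 - 1 =
      ((expo x)\<^sup>2 - 1) + 2 * (expo x * (expo x * a)) + (expo x)\<^sup>2 * (a * a)"
    using assms by (simp add: expo_add in_Ann_in_M expo_Ann power2_eq_square algebra_simps)
  ultimately have "(expo (x + a))\<^sup>2 - 1 = ((expo x)\<^sup>2 - 1) + scale 2 a"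
    by (simp add: scale_numeral_eq_mult)
  moreover have "scale 2 a \<in> Ann M" using assms subspace_scale[OF subspace_Ann] by blast
  ultimately show ?thesis
    using assms by (simp only: proj_add[OF \<rho>] expo_square_minus_1_in_M in_Ann_in_M proj_Ann[OF \<rho>])
qed

lemma no_chord_in_Ann:
  assumes \<rho>: "admissible_projection scale M \<rho>" and "a \<in> Ann M"
    and "x \<in> hypersurface scale M \<rho>" "x + a \<in> hypersurface scale M \<rho>"
  shows "a = 0"
proof -
  have "x \<in> M" using assms(3) hypersurface_iff[OF \<rho>] by blast
  from proj_expo_add_Ann[OF \<rho> this assms(2)] show ?thesis
    using assms(3,4) by (simp add: hypersurface_iff[OF \<rho>])
qed

text \<open>With \<open>e = expo v - 1\<close> the hypothesis concerns \<open>e * (2 + e)\<close>,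
  whose second factor is a unit, so \<open>e\<close> lies in the annihilator. There the logarithm of
  \<open>1 + e\<close> is \<open>e\<close> itself, hence \<open>v = e\<close>.\<close>

lemma expo_square_minus_1_in_Ann:
  assumes v: "v \<in> M" and u: "(expo v)\<^sup>2 - 1 \<in> Ann M" shows "v \<in> Ann M"
proof -
  define e where "e = expo v - 1"
  have eM: "e \<in> M" unfolding e_def using v by (rule expo_minus_1_in_M)
  have "2 + e \<notin> M"
  proof
    assume "2 + e \<in> M"
    then have "2 + e - e \<in> M" using eM by (rule diff_in_M)
    \<comment> \<open>Halving 2 is possible in characteristic zero and would put 1 into
      \<open>M\<close>.\<close>
    then have "scale (1 / 2) (2 * 1) \<in> M" by (intro scale_in_M) simp
    then show False using one_notin_M by (simp flip: scale_numeral_eq_mult del: mult_1_right)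
  qed
  then obtain y where y: "(2 + e) * y = 1" using unit_if_notin_M by blast
  have "e * ((2 + e) * y) = y * ((expo v)\<^sup>2 - 1)"
    unfolding e_def by (simp add: power2_eq_square algebra_simps)
  then have "e = y * ((expo v)\<^sup>2 - 1)" unfolding y by simp
  then have e: "e \<in> Ann M" using ideal_Ann u unfolding subspace_mult_iff by blast
  have "log_one_plus scale e = e"
    using fps_eval_Ann[OF e, of "fps_ln 1"] eM by (simp add: log_one_plus_eq fps_ln_nth)
  then have "v = e" unfolding e_def using log_expo[OF v] by simp
  with e show ?thesis by simp
qed

text \<open>A chord in direction \<open>v\<close> starting at \<open>y\<close> exists exactly when
  \<open>v\<close> lies on the hypersurface of \<open>twist \<rho> y\<close>, that is, when this
  twist kills \<open>u = (expo v)\<^sup>2 - 1\<close>. As \<open>u\<close> is outside the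
  annihilator, nondegeneracy leaves room to choose such a \<open>y\<close>.\<close>

lemma chord_outside_Ann:
  assumes \<rho>: "admissible_projection scale M \<rho>" and v: "v \<in> M" "v \<notin> Ann M"
  obtains x where "x \<in> hypersurface scale M \<rho>" "v + x \<in> hypersurface scale M \<rho>"
proof -
  define u where "u = (expo v)\<^sup>2 - 1"
  have u: "u \<in> M" "u \<notin> Ann M"
    unfolding u_def using v expo_square_minus_1_in_M expo_square_minus_1_in_Ann by blast+
  then obtain w where w: "w \<in> M" "\<rho> (u * w) \<noteq> 0" using proj_nondegenerate[OF \<rho>] by blast
  obtain s where s: "Ann M = span {s}" by (rule Ann_span_singleton)
  have "\<rho> (u * w) \<in> range (\<lambda>k. scale k s)" "\<rho> u \<in> range (\<lambda>k. scale k s)"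
    using proj_in_Ann[OF \<rho>] u w unfolding span_singleton[symmetric] s[symmetric] by blast+
  then obtain c d where cd: "\<rho> (u * w) = scale c s" "\<rho> u = scale d s" by blast
  with w have "c \<noteq> 0" by auto
  \<comment> \<open>The solution of \<open>d + k * c = 0\<close>, which makes
    \<open>\<rho> u + scale k (\<rho> (u * w))\<close> vanish.\<close>
  define k where "k = - d / c"
  have "scale k w \<in> M" using w by blast
  then obtain y where y: "y \<in> hypersurface scale M \<rho>"
    and tw: "\<And>v. v \<in> M \<Longrightarrow> twist \<rho> y v = \<rho> ((1 + scale k w) * v)"
    using point_with_twist[OF \<rho>] by blast
  have yM: "y \<in> M" using y hypersurface_iff[OF \<rho>] by blast
  have "(1 + scale k w) * u = u + scale k (u * w)"
    by (simp add: distrib_right mult.commute[of u w] flip: scale_mult_left)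
  then have "twist \<rho> y u = \<rho> u + scale k (\<rho> (u * w))"
    using tw u w by (simp add: proj_add[OF \<rho>] proj_scale[OF \<rho>] mult_in_M scale_in_M)
  also have "\<dots> = 0" using cd \<open>c \<noteq> 0\<close> by (simp add: k_def flip: scale_left_distrib)
  finally have "v \<in> hypersurface scale M (twist \<rho> y)"
    using v yM by (simp add: hypersurface_iff[OF twist_admissible[OF \<rho>]] u_def)
  with that y hypersurface_twist_iff[OF \<rho> y v(1)] show ?thesis by blast
qed

section \<open>Linear equivalences of hypersurfaces and algebra automorphisms\<close>

lemma proj_expo_scale:
  assumes \<rho>: "linear_endo scale M \<rho>" and x: "x \<in> M" "x ^ N = 0"
  shows "\<rho> ((expo (scale t x))\<^sup>2 - 1) =
    (\<Sum>j<N. scale (t ^ j) (scale ((fps_exp 1 - 1) $ j * 2 ^ j) (\<rho> (x ^ j))))"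
proof -
  have tx: "scale t x \<in> M" using x by blast
  have pow: "scale c x ^ j = scale (c ^ j) (x ^ j)" for c j
    by (induction j) (simp_all add: scale_mult_scale)
  \<comment> \<open>For \<open>j = 0\<close> the power is 1, which lies outside \<open>M\<close>,
    where nothing is known about \<open>\<rho>\<close>; the zero constant coefficient of
    \<open>fps_exp 1 - 1\<close> removes this term.\<close>
  have coeff: "scale ((fps_exp 1 - 1) $ j * c) (x ^ j) \<in> M \<and>
      \<rho> (scale ((fps_exp 1 - 1) $ j * c) (x ^ j)) = scale ((fps_exp 1 - 1) $ j * c) (\<rho> (x ^ j))"
    for c j
  proof (cases j)
    case (Suc k)
    then have "x ^ j \<in> M" using x(1) by auto
    then show ?thesis using linear_endo_scale[OF \<rho>] by blast
  qed (simp add: linear_endo_0[OF \<rho>])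
  have "scale t x + scale t x = scale (2 * t) x" by (simp flip: scale_left_distrib)
  then have "(expo (scale t x))\<^sup>2 - 1 = expo (scale (2 * t) x) - 1"
    unfolding power2_eq_square expo_add[OF tx tx, symmetric] by simp
  also have "\<dots> = (\<Sum>j<N. scale ((fps_exp 1 - 1) $ j * (2 * t) ^ j) (x ^ j))"
    using fps_eval_eq_sum[of "scale (2 * t) x" N "fps_exp 1 - 1"] x
    by (simp only: expo_minus_1 scale_in_M pow scale_zero_right scale_scale)
  finally have "\<rho> ((expo (scale t x))\<^sup>2 - 1) =
      (\<Sum>j<N. scale ((fps_exp 1 - 1) $ j * (2 * t) ^ j) (\<rho> (x ^ j)))"
    using coeff by (simp only: linear_endo_sum[OF \<rho>] finite_lessThan)
  then show ?thesis by (simp add: power_mult_distrib mult_ac)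
qed

text \<open>
  The annihilator consists of \<open>0\<close> and the vectors that are not a difference of two points of the
  hypersurface, so \<open>L\<close> preserves it; on the annihilator direction the defining function
  \<open>x \<mapsto> \<rho> (exp (2 * x) - 1)\<close> is affine, so \<open>L\<close> also intertwines the defining functions.
  Replacing \<open>x\<close> by \<open>t * x\<close> separates their homogeneous components.
\<close>

lemma linear_equivalence_powers:
  assumes \<rho>: "admissible_projection scale M \<rho>" and \<rho>': "admissible_projection scale M \<rho>'"
    and L: "linear_endo scale M L" and bij: "bij_betw L M M"
    and iff: "\<And>x. x \<in> M \<Longrightarrow> x \<in> hypersurface scale M \<rho> \<longleftrightarrow> L x \<in> hypersurface scale M \<rho>'"
    and x: "x \<in> M" and j: "1 \<le> j"
  shows "\<rho>' (L x ^ j) = L (\<rho> (x ^ j))"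
proof -
  have L_Ann: "L a \<in> Ann M" if a: "a \<in> Ann M" for a
  proof (rule ccontr)
    assume neg: "L a \<notin> Ann M"
    have aM: "a \<in> M" using a by (rule in_Ann_in_M)
    obtain p where p: "p \<in> hypersurface scale M \<rho>'" "L a + p \<in> hypersurface scale M \<rho>'"
      using chord_outside_Ann[OF \<rho>' linear_endo_in_M[OF L aM] neg] .
    then have "p \<in> L ` M" using hypersurface_iff[OF \<rho>'] bij by (auto simp: bij_betw_def)
    then obtain q where q: "q \<in> M" "p = L q" by blast
    have "q + a \<in> hypersurface scale M \<rho>"
      using p q aM by (simp add: iff add_in_M linear_endo_add[OF L] add.commute)
    moreover have "q \<in> hypersurface scale M \<rho>" using p q iff by blast
    ultimately have "a = 0" using no_chord_in_Ann[OF \<rho> a] by blast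
    with neg show False using linear_endo_0[OF L] subspace_0[OF subspace_Ann] by simp
  qed
  have intertwine: "\<rho>' ((expo (L y))\<^sup>2 - 1) = L (\<rho> ((expo y)\<^sup>2 - 1))" if y: "y \<in> M" for y
  proof -
    define b where "b = \<rho> ((expo y)\<^sup>2 - 1)"
    \<comment> \<open>The shift along the annihilator that brings \<open>y\<close> onto the
      hypersurface: by slope 2 the value \<open>b\<close> becomes
      \<open>b + scale 2 a = 0\<close>.\<close>
    define a where "a = scale (- 1 / 2) b"
    have b: "b \<in> Ann M" unfolding b_def using y expo_square_minus_1_in_M proj_in_Ann[OF \<rho>] by blast
    then have a: "a \<in> Ann M" unfolding a_def using subspace_scale[OF subspace_Ann] by blast
    have aM: "a \<in> M" using a by (rule in_Ann_in_M)
    have "scale 2 a = - b" unfolding a_def by simp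
    then have "y + a \<in> hypersurface scale M \<rho>"
      using proj_expo_add_Ann[OF \<rho> y a] y aM
      by (simp add: hypersurface_iff[OF \<rho>] add_in_M b_def)
    then have "L y + L a \<in> hypersurface scale M \<rho>'"
      using y aM by (simp add: iff add_in_M linear_endo_add[OF L])
    then have "\<rho>' ((expo (L y))\<^sup>2 - 1) + scale 2 (L a) = 0"
      using proj_expo_add_Ann[OF \<rho>' linear_endo_in_M[OF L y] L_Ann[OF a]]
      by (simp add: hypersurface_iff[OF \<rho>'])
    moreover have "L a = scale (- 1 / 2) (L b)"
      unfolding a_def by (rule linear_endo_scale[OF L in_Ann_in_M[OF b]])
    then have "scale 2 (L a) = - L b" by simp
    ultimately show ?thesis unfolding b_def by simp
  qed
  obtain N1 N2 where N1: "x ^ N1 = 0" and N2: "L x ^ N2 = 0"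
    using nilpotent x linear_endo_in_M[OF L x] by metis
  \<comment> \<open>A common truncation bound for both expansions that also exceeds
    \<open>j\<close>.\<close>
  define N where "N = Suc j + N1 + N2"
  have N: "x ^ N = 0" "L x ^ N = 0" "j < N"
    using power_eq_0_mono[OF N1] power_eq_0_mono[OF N2] unfolding N_def by auto
  let ?c = "\<lambda>i. (fps_exp 1 - 1) $ i * 2 ^ i :: 'f"
  let ?v = "\<lambda>i. scale (?c i) (\<rho>' (L x ^ i) - L (\<rho> (x ^ i)))"
  have "(\<Sum>i<N. scale (t ^ i) (?v i)) = 0" for t
  proof -
    have tx: "scale t x \<in> M" using x by blast
    have in_M: "scale (t ^ i) (scale (?c i) (\<rho> (x ^ i))) \<in> M \<and>
        L (scale (t ^ i) (scale (?c i) (\<rho> (x ^ i)))) = scale (t ^ i) (scale (?c i) (L (\<rho> (x ^ i))))" for i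
    proof (cases i)
      case (Suc k)
      then have "\<rho> (x ^ i) \<in> M" using x proj_in_M[OF \<rho>] by auto
      then show ?thesis by (simp add: linear_endo_scale[OF L] scale_in_M)
    qed (simp add: linear_endo_0[OF L])
    have "(\<Sum>i<N. scale (t ^ i) (scale (?c i) (\<rho>' (L x ^ i)))) = \<rho>' ((expo (L (scale t x)))\<^sup>2 - 1)"
      using proj_expo_scale[OF linear_endo_projection[OF \<rho>'] linear_endo_in_M[OF L x] N(2)]
      by (simp only: linear_endo_scale[OF L x])
    also have "\<dots> = L (\<Sum>i<N. scale (t ^ i) (scale (?c i) (\<rho> (x ^ i))))"
      using proj_expo_scale[OF linear_endo_projection[OF \<rho>] x N(1)] intertwine[OF tx] by (simp only:)
    also have "\<dots> = (\<Sum>i<N. scale (t ^ i) (scale (?c i) (L (\<rho> (x ^ i)))))"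
      using in_M by (simp only: linear_endo_sum[OF L] finite_lessThan)
    finally show ?thesis by (simp only: scale_right_diff_distrib sum_subtractf) simp
  qed
  from vector_polynomial_eq_0[where N = N and v = ?v, OF this N(3)] have "?v j = 0" .
  \<comment> \<open>The coefficient is \<open>2 ^ j / fact j\<close>; only at index 0 does
    subtracting 1 make it vanish.\<close>
  moreover have "?c j \<noteq> 0" using j by simp
  ultimately show ?thesis by simp
qed

lemma linear_equivalence_intertwines:
  assumes \<rho>: "admissible_projection scale M \<rho>" and \<rho>': "admissible_projection scale M \<rho>'"
    and L: "linear_endo scale M L" and bij: "bij_betw L M M"
    and iff: "\<And>x. x \<in> M \<Longrightarrow> x \<in> hypersurface scale M \<rho> \<longleftrightarrow> L x \<in> hypersurface scale M \<rho>'"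
    and x: "x \<in> M"
  shows "\<rho>' (L x) = L (\<rho> x)"
proof -
  have "\<rho>' (L x ^ 1) = L (\<rho> (x ^ 1))"
    by (rule linear_equivalence_powers[OF \<rho> \<rho>' L bij iff x order_refl])
  then show ?thesis by simp
qed

text \<open>
  The forms \<open>(x, y) \<mapsto> \<rho> (x * y)\<close> and \<open>(x, y, z) \<mapsto> \<rho> (x * y * z)\<close> determine the multiplication,
  by nondegeneracy modulo the annihilator.
\<close>

lemma linear_equivalence_mult:
  assumes \<rho>: "admissible_projection scale M \<rho>" and \<rho>': "admissible_projection scale M \<rho>'"
    and L: "linear_endo scale M L" and bij: "bij_betw L M M"
    and iff: "\<And>x. x \<in> M \<Longrightarrow> x \<in> hypersurface scale M \<rho> \<longleftrightarrow> L x \<in> hypersurface scale M \<rho>'"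
    and x: "x \<in> M" and y: "y \<in> M"
  shows "L (x * y) = L x * L y"
proof -
  note LM = linear_endo_in_M[OF L]
  note lin = linear_endo_add linear_endo_diff linear_endo_scale
  note R = lin[OF linear_endo_projection[OF \<rho>]] and R' = lin[OF linear_endo_projection[OF \<rho>']]
    and Llin = lin[OF L]
  note closed = add_in_M diff_in_M mult_in_M scale_in_M LM proj_in_M[OF \<rho>]
  note powers = linear_equivalence_powers[OF \<rho> \<rho>' L bij iff]
  have pow_M: "u ^ 2 \<in> M" "u ^ 3 \<in> M" if "u \<in> M" for u
    using that by (simp_all add: power2_eq_square power3_eq_cube mult_in_M)
  have two: "\<rho>' (L a * L b) = L (\<rho> (a * b))" if ab: "a \<in> M" "b \<in> M" for a b
  proof -
    \<comment> \<open>Polarization recovers the bilinear form from squares.\<close>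
    have id: "scale 4 (u * v) = (u + v) ^ 2 - (u - v) ^ 2" for u v :: 'a
      unfolding scale_numeral_eq_mult by (simp add: power2_eq_square algebra_simps)
    have "scale 4 (\<rho>' (L a * L b)) = \<rho>' ((L a + L b) ^ 2) - \<rho>' ((L a - L b) ^ 2)"
      using ab by (simp add: closed pow_M id flip: R')
    also have "\<dots> = L (\<rho> ((a + b) ^ 2)) - L (\<rho> ((a - b) ^ 2))"
      using powers[of "a + b" 2] powers[of "a - b" 2] ab by (simp add: closed Llin)
    also have "\<dots> = scale 4 (L (\<rho> (a * b)))"
      using ab by (simp add: closed pow_M id flip: R Llin)
    finally show ?thesis by simp
  qed
  have three: "\<rho>' (L a * L b * L c) = L (\<rho> (a * b * c))"
    if abc: "a \<in> M" "b \<in> M" "c \<in> M" for a b c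
  proof -
    \<comment> \<open>The cubic analogue: signed cubes recover the trilinear form.\<close>
    have id: "scale 24 (u * v * w) =
        (u + v + w) ^ 3 - (u + v - w) ^ 3 - ((u - v + w) ^ 3 - (u - v - w) ^ 3)" for u v w :: 'a
      unfolding scale_numeral_eq_mult by (simp add: power3_eq_cube algebra_simps)
    have "scale 24 (\<rho>' (L a * L b * L c)) =
        \<rho>' ((L a + L b + L c) ^ 3) - \<rho>' ((L a + L b - L c) ^ 3) -
        (\<rho>' ((L a - L b + L c) ^ 3) - \<rho>' ((L a - L b - L c) ^ 3))"
      using abc by (simp add: closed pow_M id flip: R')
    also have "\<dots> = L (\<rho> ((a + b + c) ^ 3)) - L (\<rho> ((a + b - c) ^ 3)) -
        (L (\<rho> ((a - b + c) ^ 3)) - L (\<rho> ((a - b - c) ^ 3)))"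
      using powers[of "a + b + c" 3] powers[of "a + b - c" 3]
        powers[of "a - b + c" 3] powers[of "a - b - c" 3] abc
      by (simp add: closed Llin)
    also have "\<dots> = scale 24 (L (\<rho> (a * b * c)))"
      using abc by (simp add: closed pow_M id flip: R Llin)
    finally show ?thesis by simp
  qed
  \<comment> \<open>The defect of multiplicativity pairs to 0 with every \<open>L z\<close>, because
    both terms give \<open>L (\<rho> (x * y * z))\<close>: one by the trilinear form, the other by
    the bilinear form at \<open>x * y\<close> and \<open>z\<close>.\<close>
  define d where "d = L x * L y - L (x * y)"
  have dM: "d \<in> M" unfolding d_def using x y by (simp add: closed)
  have "\<rho>' (d * v) = 0" if "v \<in> M" for v
  proof -
    obtain z where z: "z \<in> M" "v = L z" using bij \<open>v \<in> M\<close> by (auto simp: bij_betw_def)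
    then show ?thesis
      unfolding d_def left_diff_distrib
      using x y z two[of "x * y" z] three[of x y z] by (simp add: closed R')
  qed
  then have "d \<in> Ann M" using proj_nondegenerate[OF \<rho>' dM] by blast
  \<comment> \<open>Nondegeneracy only places \<open>d\<close> in the annihilator. There
    \<open>\<rho>'\<close> is the identity, and it sends both terms of \<open>d\<close> to
    \<open>L (\<rho> (x * y))\<close>.\<close>
  then have "d = \<rho>' d" by (simp add: proj_Ann[OF \<rho>'])
  also have "\<dots> = 0"
    unfolding d_def
    using x y two[of x y] linear_equivalence_intertwines[OF \<rho> \<rho>' L bij iff, of "x * y"]
    by (simp add: closed R')
  finally show ?thesis unfolding d_def by simp
qed

lemma linear_equivalence_kernel:
  assumes \<rho>: "admissible_projection scale M \<rho>" and \<rho>': "admissible_projection scale M \<rho>'"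
    and L: "linear_endo scale M L" and bij: "bij_betw L M M"
    and iff: "\<And>x. x \<in> M \<Longrightarrow> x \<in> hypersurface scale M \<rho> \<longleftrightarrow> L x \<in> hypersurface scale M \<rho>'"
  shows "L ` kernel \<rho> = kernel \<rho>'"
proof -
  note inter = linear_equivalence_intertwines[OF \<rho> \<rho>' L bij iff]
  have zero: "\<rho>' (L x) = 0 \<longleftrightarrow> \<rho> x = 0" if "x \<in> M" for x
  proof -
    have "L (\<rho> x) = L 0 \<longleftrightarrow> \<rho> x = 0"
      using bij that proj_in_M[OF \<rho>] by (intro inj_on_eq_iff[of L M]) (auto simp: bij_betw_def)
    then show ?thesis using inter[OF _ that] linear_endo_0[OF L] by simp
  qed
  have LM: "L ` M = M" using bij by (simp add: bij_betw_def)
  show ?thesis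
  proof (intro subset_antisym subsetI)
    fix v assume "v \<in> kernel \<rho>'"
    then have "v \<in> L ` M" "\<rho>' v = 0" unfolding LM kernel_def by auto
    then obtain x where "x \<in> M" "v = L x" "\<rho>' (L x) = 0" by blast
    then show "v \<in> L ` kernel \<rho>" using zero unfolding kernel_def by blast
  next
    fix v assume "v \<in> L ` kernel \<rho>"
    then show "v \<in> kernel \<rho>'" using zero linear_endo_in_M[OF L] unfolding kernel_def by auto
  qed
qed

text \<open>An automorphism preserves the annihilator and, with matching kernels, respects the
  splitting of \<open>M\<close> into kernel and annihilator, so it intertwines the projections. It
  also commutes with the series \<open>expo u - 1\<close>, and therefore carries one defining
  function to the other.\<close>

lemma Aut_hypersurface_iff:
  assumes \<rho>: "admissible_projection scale M \<rho>" and \<rho>': "admissible_projection scale M \<rho>'"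
    and \<phi>: "\<phi> \<in> Aut scale M" and ker: "\<phi> ` kernel \<rho> = kernel \<rho>'" and x: "x \<in> M"
  shows "x \<in> hypersurface scale M \<rho> \<longleftrightarrow> \<phi> x \<in> hypersurface scale M \<rho>'"
proof -
  have bij: "bij_betw \<phi> M M" and lin: "linear_endo scale M \<phi>"
    and mult: "\<And>u v. u \<in> M \<Longrightarrow> v \<in> M \<Longrightarrow> \<phi> (u * v) = \<phi> u * \<phi> v"
    using \<phi> unfolding Aut_def by auto
  have \<phi>M: "\<phi> ` M = M" using bij by (simp add: bij_betw_def)
  have Ann: "\<phi> a \<in> Ann M" if a: "a \<in> Ann M" for a
  proof -
    have aM: "a \<in> M" using a by (rule in_Ann_in_M)
    have "\<phi> a * v = 0" if "v \<in> M" for v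
    proof -
      obtain w where w: "w \<in> M" "v = \<phi> w" using \<phi>M \<open>v \<in> M\<close> by blast
      then have "\<phi> a * v = \<phi> (a * w)" using mult aM by simp
      also have "\<dots> = 0" using Ann_mult(1)[OF a w(1)] linear_endo_0[OF lin] by simp
      finally show ?thesis .
    qed
    then show ?thesis unfolding Ann_def using linear_endo_in_M[OF lin aM] by blast
  qed
  have inter: "\<rho>' (\<phi> v) = \<phi> (\<rho> v)" if v: "v \<in> M" for v
  proof -
    have \<rho>v: "\<rho> v \<in> Ann M" "\<rho> v \<in> M" using v proj_in_Ann[OF \<rho>] proj_in_M[OF \<rho>] by auto
    have k: "v - \<rho> v \<in> kernel \<rho>"
      using v \<rho>v by (simp add: kernel_def diff_in_M proj_diff[OF \<rho>] proj_Ann[OF \<rho>])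
    then have k': "\<phi> (v - \<rho> v) \<in> kernel \<rho>'" using ker by blast
    have "\<phi> v = \<phi> (v - \<rho> v) + \<phi> (\<rho> v)"
      using v \<rho>v by (simp add: linear_endo_diff[OF lin])
    moreover have "\<phi> (v - \<rho> v) \<in> M" "\<phi> (\<rho> v) \<in> M" "\<rho>' (\<phi> (v - \<rho> v)) = 0"
      using k' Ann[OF \<rho>v(1)] in_Ann_in_M unfolding kernel_def by auto
    ultimately show ?thesis using Ann[OF \<rho>v(1)] by (simp add: proj_add[OF \<rho>'] proj_Ann[OF \<rho>'])
  qed
  have expo: "\<phi> (expo u - 1) = expo (\<phi> u) - 1" if u: "u \<in> M" for u
  proof -
    have \<phi>u: "\<phi> u \<in> M" using linear_endo_in_M[OF lin u] .
    \<comment> \<open>Only products inside \<open>M\<close> are respected, so exponents start at 1;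
      the constant term is absent from \<open>fps_exp 1 - 1\<close>.\<close>
    have pow: "u ^ Suc n \<in> M \<and> \<phi> (u ^ Suc n) = \<phi> u ^ Suc n" for n
      using u by (induction n) (auto simp: mult)
    obtain N where N: "u ^ N = 0" using nilpotent u by blast
    then have N': "u ^ Suc N = 0" by simp
    then have \<phi>N: "\<phi> u ^ Suc N = 0" using pow[of N] linear_endo_0[OF lin] by simp
    have coeff: "scale ((fps_exp 1 - 1) $ n) (u ^ n) \<in> M \<and>
        \<phi> (scale ((fps_exp 1 - 1) $ n) (u ^ n)) = scale ((fps_exp 1 - 1) $ n) (\<phi> u ^ n)" for n
    proof (cases n)
      case (Suc k)
      then show ?thesis using pow[of k] by (simp add: linear_endo_scale[OF lin] scale_in_M del: power_Suc)
    qed (simp add: linear_endo_0[OF lin])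
    show ?thesis
      unfolding expo_minus_1[OF u] expo_minus_1[OF \<phi>u] fps_eval_eq_sum[OF N'] fps_eval_eq_sum[OF \<phi>N]
      using coeff by (simp only: linear_endo_sum[OF lin] finite_lessThan)
  qed
  have "(expo u)\<^sup>2 - 1 = expo (u + u) - 1" if "u \<in> M" for u
    unfolding power2_eq_square expo_add[OF that that] ..
  then have "\<phi> ((expo x)\<^sup>2 - 1) = (expo (\<phi> x))\<^sup>2 - 1"
    using expo[OF add_in_M[OF x x]] x linear_endo_in_M[OF lin x]
    by (simp only: linear_endo_add[OF lin])
  then have "\<rho>' ((expo (\<phi> x))\<^sup>2 - 1) = \<phi> (\<rho> ((expo x)\<^sup>2 - 1))"
    using inter[OF expo_square_minus_1_in_M[OF x]] by simp
  moreover have "\<phi> (\<rho> ((expo x)\<^sup>2 - 1)) = \<phi> 0 \<longleftrightarrow> \<rho> ((expo x)\<^sup>2 - 1) = 0"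
    using bij x proj_in_M[OF \<rho>] expo_square_minus_1_in_M
    by (intro inj_on_eq_iff[of \<phi> M]) (auto simp: bij_betw_def)
  ultimately show ?thesis
    using x linear_endo_in_M[OF lin x] linear_endo_0[OF lin]
    by (simp add: hypersurface_iff[OF \<rho>] hypersurface_iff[OF \<rho>'])
qed

section \<open>The two implications between transitivity and Property (P)\<close>

lemma property_P_if_transitive:
  assumes \<pi>: "admissible_projection scale M \<pi>"
    and trans: "acts_transitively (Aff_of scale M (hypersurface scale M \<pi>)) (\<lambda>f x. f x)
      (hypersurface scale M \<pi>)"
  shows "property_P scale M"
  unfolding property_P_def acts_transitively_def
proof (intro ballI)
  let ?S = "hypersurface scale M \<pi>"
  fix H H' assume H: "H \<in> complementary_hyperplanes scale M" "H' \<in> complementary_hyperplanes scale M"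
  obtain x where x: "x \<in> ?S" "kernel (twist \<pi> x) = H"
    using complementary_hyperplane_is_kernel[OF \<pi> H(1)] .
  obtain y where y: "y \<in> ?S" "kernel (twist \<pi> y) = H'"
    using complementary_hyperplane_is_kernel[OF \<pi> H(2)] .
  have SM: "?S \<subseteq> M" using hypersurface_iff[OF \<pi>] by blast
  then have xM: "x \<in> M" and yM: "y \<in> M" using x y by auto
  obtain f where f: "f \<in> Aff_of scale M ?S" "f x = y"
    using trans x y unfolding acts_transitively_def by blast
  then have bij: "bij_betw f M M" and fS: "f ` ?S = ?S"
    unfolding Aff_of_def Aff_def by auto
  obtain L b where L: "linear_endo scale M L" and b: "b \<in> M" and fL: "\<And>z. z \<in> M \<Longrightarrow> f z = L z + b"
    using f(1) unfolding Aff_of_def Aff_def by blast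
  have Lf: "L z = f z - b" if "z \<in> M" for z using fL[OF that] by simp
  have bijL: "bij_betw L M M"
    unfolding bij_betw_def
  proof (intro conjI inj_onI subset_antisym subsetI)
    show "u = v" if "u \<in> M" "v \<in> M" "L u = L v" for u v
      using that fL bij by (auto simp: bij_betw_def inj_on_def)
    show "v \<in> M" if "v \<in> L ` M" for v using that linear_endo_in_M[OF L] by blast
    show "v \<in> L ` M" if "v \<in> M" for v
    proof -
      have "v + b \<in> f ` M" using bij b that by (simp add: bij_betw_def add_in_M)
      then obtain u where "u \<in> M" "v + b = f u" by blast
      then show ?thesis using Lf by (metis add_diff_cancel_right' rev_image_eqI)
    qed
  qed
  have iff: "z \<in> hypersurface scale M (twist \<pi> x) \<longleftrightarrow> L z \<in> hypersurface scale M (twist \<pi> y)"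
    if z: "z \<in> M" for z
  proof -
    have zx: "z + x \<in> M" using z xM by blast
    have "z + x \<in> ?S \<longleftrightarrow> f (z + x) \<in> f ` ?S"
      using inj_on_image_mem_iff[OF bij_betw_imp_inj_on[OF bij] zx SM] by simp
    \<comment> \<open>Measured from the base points \<open>x\<close> and \<open>y\<close>, the map
      \<open>f\<close> is its linear part, so \<open>L\<close> matches the two translates of the
      hypersurface.\<close>
    moreover have "f (z + x) = L z + y"
      using f(2) fL[OF zx] fL[OF xM] linear_endo_add[OF L z xM] by (simp add: add.assoc)
    ultimately show ?thesis
      using hypersurface_twist_iff[OF \<pi> x(1) z]
        hypersurface_twist_iff[OF \<pi> y(1) linear_endo_in_M[OF L z]] fS by simp
  qed
  note tw = twist_admissible[OF \<pi> xM] twist_admissible[OF \<pi> yM]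
  have mult: "L (u * v) = L u * L v" if "u \<in> M" "v \<in> M" for u v
    by (rule linear_equivalence_mult[OF tw L bijL iff that])
  \<comment> \<open>Elements of \<open>Aut\<close> are extensional, while \<open>L\<close> is
    arbitrary outside \<open>M\<close>.\<close>
  have "bij_betw (restrict L M) M M"
    using bijL by (simp add: bij_betw_restrict_eq)
  moreover have "linear_endo scale M (restrict L M)"
    using L unfolding linear_endo_def by (simp add: Pi_iff add_in_M scale_in_M)
  ultimately have Aut: "restrict L M \<in> Aut scale M"
    unfolding Aut_def by (simp add: mult mult_in_M)
  have image: "restrict L M ` H = H'"
  proof -
    have "restrict L M ` H = L ` H" using x(2) unfolding kernel_def by (intro image_cong) auto
    also have "\<dots> = H'"
      using linear_equivalence_kernel[OF tw L bijL iff] unfolding x(2) y(2) .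
    finally show ?thesis .
  qed
  show "\<exists>\<phi>\<in>Aut scale M. \<phi> ` H = H'" using image Aut by (rule bexI)
qed

lemma transitive_if_property_P:
  assumes \<pi>: "admissible_projection scale M \<pi>" and P: "property_P scale M"
  shows "acts_transitively (Aff_of scale M (hypersurface scale M \<pi>)) (\<lambda>f x. f x)
    (hypersurface scale M \<pi>)"
  unfolding acts_transitively_def
proof (intro ballI)
  let ?S = "hypersurface scale M \<pi>"
  fix x y assume x: "x \<in> ?S" and y: "y \<in> ?S"
  have SM: "?S \<subseteq> M" using hypersurface_iff[OF \<pi>] by blast
  then have xM: "x \<in> M" and yM: "y \<in> M" using x y by auto
  note tw = twist_admissible[OF \<pi> xM] twist_admissible[OF \<pi> yM]
  obtain \<phi> where \<phi>: "\<phi> \<in> Aut scale M" "\<phi> ` kernel (twist \<pi> x) = kernel (twist \<pi> y)"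
    using P kernel_complementary[OF tw(1)] kernel_complementary[OF tw(2)]
    unfolding property_P_def acts_transitively_def by blast
  then have bij: "bij_betw \<phi> M M" and lin: "linear_endo scale M \<phi>" unfolding Aut_def by auto
  \<comment> \<open>The affine map with linear part \<open>\<phi>\<close> that sends
    \<open>x\<close> to \<open>y\<close>, made extensional as \<open>Aff\<close> demands.\<close>
  define f where "f = restrict (\<lambda>z. \<phi> (z - x) + y) M"
  have f: "f z = \<phi> (z - x) + y" if "z \<in> M" for z using that by (simp add: f_def)
  have bijf: "bij_betw f M M"
    unfolding bij_betw_def
  proof (intro conjI inj_onI subset_antisym subsetI)
    show "u = v" if "u \<in> M" "v \<in> M" "f u = f v" for u v
    proof -
      have "\<phi> (u - x) = \<phi> (v - x)" using that f by simp
      then have "u - x = v - x"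
        using bij that xM diff_in_M unfolding bij_betw_def inj_on_def by blast
      then show ?thesis by simp
    qed
    show "v \<in> M" if "v \<in> f ` M" for v
    proof -
      obtain u where u: "u \<in> M" "v = f u" using \<open>v \<in> f ` M\<close> by blast
      have "\<phi> (u - x) \<in> M" by (rule linear_endo_in_M[OF lin diff_in_M[OF u(1) xM]])
      then show ?thesis using u f yM by (simp add: add_in_M)
    qed
    show "v \<in> f ` M" if "v \<in> M" for v
    proof -
      have "v - y \<in> \<phi> ` M" using bij that yM by (simp add: bij_betw_def diff_in_M)
      then obtain u where u: "u \<in> M" "v - y = \<phi> u" by blast
      then have "f (u + x) = v" using f xM by (simp add: add_in_M flip: u(2))
      with u xM show ?thesis by blast
    qed
  qed
  have iff: "z \<in> ?S \<longleftrightarrow> f z \<in> ?S" if z: "z \<in> M" for z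
  proof -
    have zx: "z - x \<in> M" using z xM by blast
    show ?thesis
      using Aut_hypersurface_iff[OF tw \<phi> zx] hypersurface_twist_iff[OF \<pi> x zx]
        hypersurface_twist_iff[OF \<pi> y linear_endo_in_M[OF lin zx]] f[OF z]
      by simp
  qed
  have "f ` ?S = ?S"
  proof (intro subset_antisym subsetI)
    show "v \<in> ?S" if "v \<in> f ` ?S" for v using that iff SM by blast
    show "v \<in> f ` ?S" if "v \<in> ?S" for v
    proof -
      have "v \<in> f ` M" using that SM bijf by (auto simp: bij_betw_def)
      then show ?thesis using that iff by blast
    qed
  qed
  moreover have "f \<in> Aff scale M"
  proof -
    have "y - \<phi> x \<in> M" using yM linear_endo_in_M[OF lin xM] by blast
    moreover have "\<forall>z\<in>M. f z = \<phi> z + (y - \<phi> x)"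
      using f xM by (simp add: linear_endo_diff[OF lin])
    ultimately have "\<exists>L. linear_endo scale M L \<and> (\<exists>b\<in>M. \<forall>z\<in>M. f z = L z + b)"
      using lin by blast
    moreover have "f \<in> extensional M" by (simp add: f_def)
    ultimately show ?thesis unfolding Aff_def using bijf by blast
  qed
  moreover have "f x = y" using f[OF xM] linear_endo_0[OF lin] by simp
  ultimately show "\<exists>f\<in>Aff_of scale M ?S. f x = y" unfolding Aff_of_def by blast
qed

end

theorem theorem2p2:
  fixes scale :: "'f::field_char_0 \<Rightarrow> 'a::comm_ring_1 \<Rightarrow> 'a"
    and M :: "'a set"
    and \<pi> :: "'a \<Rightarrow> 'a"
  assumes "gorenstein_algebra scale M"
    and "admissible_projection scale M \<pi>"
  shows "acts_transitively
           (Aff_of scale M (hypersurface scale M \<pi>)) (\<lambda>f x. f x) (hypersurface scale M \<pi>)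
         \<longleftrightarrow> property_P scale M"
proof -
  interpret gorenstein_algebra scale M by (rule assms(1))
  show ?thesis
    using property_P_if_transitive[OF assms(2)] transitive_if_property_P[OF assms(2)] by blast
qed

end
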